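(* Let $X_1,X_2,\ldots$ be i.i.d. non-negative random variables with common distribution function $F$ having unbounded support on the positive half-line, and suppose that $F$ is subexponential ($F\in\mathcal S$). Let $0<p<1$ and let $\nu$ be independent of $(X_i)_{i\ge 1}$ with $\mathbf{P}(\nu=k)=p(1-p)^{k-1}$, $k\ge 1$. Put $S_\nu=\sum_{i=1}^{\nu}X_i$ and $$\Delta(x)=\frac{\mathbf{P}(S_\nu>x)-\mathbf{E}\nu\,\overline F(x)}{\mathbf{E}\nu\,\overline F(x)} .$$ Let $h:(0,\infty)\to(0,\infty)$ be an increasing concave function with $h(x)\to\infty$ as $x\to\infty$, $h(x)<x/2$ for all sufficiently large $x$, and $$\overline F(x-h(x))\sim\overline F(x)\quad\text{as }x\to\infty .$$ Let $g:(0,\infty)\to(0,\infty)$ be a function such that, as $x\to\infty$, \begin{align*} & g(x)\to 0 \text{ monotonically},\\ & \max\big(J(x,h(x)),K(x,h(x))\big)=O(g(x)),\\ & g(x-h(x))\sim g(x), \end{align*} where $J$ and $K$ are the quantities associated with $F$ defined in the context. Let $C(x)=\max\left(0,\frac{\Delta(x)}{g(x)}\right)$ and $C[a,b]=\sup_{a\le x\le b}C(x)$. Then there exist $b>0$, $0<\delta<1$ and $\phi>0$ such that, for all $x\ge b$, $$\Delta(x)\le \Delta_u(x):=C\,g(x),\qquad\text{where}\qquad C=\max\left(\frac{\phi}{1-\delta},\ \phi+\delta\, C[h(b),b]\right).$$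
   Context: Notation: $\overline F(x)=1-F(x)$, and $F^{*n}$ is the $n$-fold convolution of $F$. A distribution $F$ on the positive half-line is subexponential, $F\in\mathcal S$, if $\overline{F^{*2}}(x)\sim 2\overline F(x)$ as $x\to\infty$. For functions $a(x)\ge 0$, $b(x)\ge 0$: $a(x)\sim b(x)$ means $\lim_{x\to\infty}a(x)/b(x)=1$; $a(x)=O(b(x))$ means $0<\limsup_{x\to\infty}a(x)/b(x)<\infty$. For a distribution $F$, $$K(x,r)=\frac{\overline F(x-r)}{\overline F(x)}-1,\qquad J(x,r)=\int_r^{x-r}\frac{\overline F(x-y)}{\overline F(x)}\,F(dy),$$ where the integral is over $y\in(r,x-r]$ (and is $0$ if this interval is empty). Since $\nu$ is geometric, $\mathbf{E}\nu=1/p$. *)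

theory Defs
  imports "HOL-Probability.Probability"
begin

text \<open>A distribution is represented by its law \<open>D :: real measure\<close>, so that \<open>F\<close> is \<open>cdf D\<close> and
  integration against \<open>F(dy)\<close> is integration with respect to \<open>D\<close>.\<close>

definition tail :: "real measure \<Rightarrow> real \<Rightarrow> real" where
  "tail D x = 1 - cdf D x"

definition law_support :: "real measure \<Rightarrow> real set" where
  "law_support D = {x. \<forall>e>0. measure D {x - e<..<x + e} > 0}"

text \<open>The asymptotic equivalence is written as a limit of quotients, and not with
  \<^const>\<open>asymp_equiv\<close>, because the latter reads \<open>0/0\<close> as \<open>1\<close> and would therefore
  make every distribution with bounded support subexponential.\<close>

definition subexponential :: "real measure \<Rightarrow> bool" where
  "subexponential D \<longleftrightarrow>
     real_distribution D \<and> measure D {..<0} = 0 \<and>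
     ((\<lambda>x. tail (convolution D D) x / (2 * tail D x)) \<longlongrightarrow> 1) at_top"

definition Kfun :: "real measure \<Rightarrow> real \<Rightarrow> real \<Rightarrow> real" where
  "Kfun D x r = tail D (x - r) / tail D x - 1"

definition Jfun :: "real measure \<Rightarrow> real \<Rightarrow> real \<Rightarrow> real" where
  "Jfun D x r = (LINT y:{r<..x - r}|D. tail D (x - y) / tail D x)"

text \<open>Here \<open>a(x) = O(b(x))\<close> also requires the upper limit of the quotient to be positive,
  unlike the Landau symbol of the library.\<close>

definition strict_bigo :: "(real \<Rightarrow> real) \<Rightarrow> (real \<Rightarrow> real) \<Rightarrow> bool" where
  "strict_bigo a b \<longleftrightarrow>
     0 < Limsup at_top (\<lambda>x. ereal (a x / b x)) \<and>
     Limsup at_top (\<lambda>x. ereal (a x / b x)) < \<infinity>"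

text \<open>The same notion as \<^const>\<open>prob_space.indep_var\<close>, which requires the two random
  variables to take values in the same type: they are measurable and generate independent
  sigma-algebras.\<close>

definition indep_rv ::
  "'a measure \<Rightarrow> 'b measure \<Rightarrow> ('a \<Rightarrow> 'b) \<Rightarrow> 'c measure \<Rightarrow> ('a \<Rightarrow> 'c) \<Rightarrow> bool" where
  "indep_rv M A Y B Z \<longleftrightarrow>
     Y \<in> measurable M A \<and> Z \<in> measurable M B \<and>
     prob_space.indep_set M (sets (vimage_algebra (space M) Y A))
                            (sets (vimage_algebra (space M) Z B))"

definition random_sum :: "(nat \<Rightarrow> 'a \<Rightarrow> real) \<Rightarrow> ('a \<Rightarrow> nat) \<Rightarrow> 'a \<Rightarrow> real" where
  "random_sum X \<nu> \<omega> = (\<Sum>i=1..\<nu> \<omega>. X i \<omega>)"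

definition Delta ::
  "'a measure \<Rightarrow> (nat \<Rightarrow> 'a \<Rightarrow> real) \<Rightarrow> ('a \<Rightarrow> nat) \<Rightarrow> real measure \<Rightarrow> real \<Rightarrow> real" where
  "Delta M X \<nu> D x =
     (measure M {\<omega> \<in> space M. random_sum X \<nu> \<omega> > x} - (LINT \<omega>|M. real (\<nu> \<omega>)) * tail D x)
       / ((LINT \<omega>|M. real (\<nu> \<omega>)) * tail D x)"

definition rel_excess :: "(real \<Rightarrow> real) \<Rightarrow> (real \<Rightarrow> real) \<Rightarrow> real \<Rightarrow> real" where
  "rel_excess \<Delta> g x = max 0 (\<Delta> x / g x)"

definition sup_between :: "(real \<Rightarrow> real) \<Rightarrow> real \<Rightarrow> real \<Rightarrow> real" where
  "sup_between c a b = (SUP x\<in>{a..b}. c x)"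

end

theory Submission
  imports Defs
begin

text \<open>Conditioning on the first summand, \<open>G x = P (S\<^sub>\<nu> > x)\<close> satisfies the renewal equation
  \<open>G x = p F\<^sub>c x + (1 - p) \<integral> G (x - y) F(dy)\<close> with \<open>F\<^sub>c\<close> the tail of \<open>F\<close>. Splitting the integral
  at \<open>h x\<close> and \<open>x - h x\<close> bounds \<open>\<Delta> x / g x\<close> by \<open>\<phi> + \<delta> A\<close> whenever \<open>A\<close> bounds
  \<open>C\<close> on \<open>[h x, x]\<close>; here \<open>\<delta>\<close> is close to \<open>1 - p\<close>, because only the part \<open>y \<le> h x\<close>
  contributes a multiple of \<open>A\<close> that is not negligible. The finite supremum \<open>S\<close> of \<open>C\<close> on \<open>[b, x]\<close>
  therefore satisfies \<open>S \<le> \<phi> + \<delta> max (C[h(b), b]) S\<close>, which is solved for \<open>S\<close>.\<close>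

section \<open>Tails of real distributions and of convolutions\<close>

context real_distribution
begin

lemma tail_eq_measure: "tail M x = measure M {x<..}"
proof -
  have "{x<..} = space M - {..x}"
    by (auto simp: borel_UNIV)
  then show ?thesis
    unfolding tail_def cdf_def by (metis prob_compl atMost_borel events_eq_borel)
qed

lemma tail_nonneg: "0 \<le> tail M x"
  by (simp add: tail_eq_measure)

lemma tail_le_1: "tail M x \<le> 1"
  by (simp add: tail_eq_measure)

lemma tail_antimono: "x \<le> y \<Longrightarrow> tail M y \<le> tail M x"
  unfolding tail_def using cdf_nondecreasing by simp

lemma borel_measurable_tail [measurable]: "tail M \<in> borel_measurable borel"
proof -
  have "(\<lambda>x. - tail M x) \<in> borel_measurable borel"
    by (intro borel_measurable_mono) (simp add: mono_def tail_antimono)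
  then show ?thesis
    by simp
qed

end

text \<open>Fubini for the law of a sum. The factors are swapped first so that the outer integration
  is with respect to \<open>D\<close>; the integrand lies between 0 and 1, so the nonnegative
  integral is a finite Lebesgue integral.\<close>

lemma tail_convolution:
  assumes "real_distribution L" "real_distribution D"
  shows "tail (L \<star> D) x = (LINT y|D. tail L (x - y))"
proof -
  interpret L: real_distribution L by fact
  interpret D: real_distribution D by fact
  have comm: "(L \<star> D) = (D \<star> L)"
    by (intro convolution_commutative) (auto simp: L.finite_measure_axioms D.finite_measure_axioms)
  interpret P: pair_prob_space D L
    by unfold_locales
  have "real_distribution (D \<star> L)"
    unfolding convolution_def by (intro P.real_distribution_distr) measurable
  then interpret C: real_distribution "D \<star> L" .
  have "emeasure (D \<star> L) {x<..} = (\<integral>\<^sup>+y. emeasure L {a. a + y \<in> {x<..}} \<partial>D)"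
    by (intro convolution_emeasure)
       (auto simp: L.finite_measure_axioms D.finite_measure_axioms L.borel_UNIV D.borel_UNIV)
  also have "\<dots> = (\<integral>\<^sup>+y. ennreal (tail L (x - y)) \<partial>D)"
  proof (intro nn_integral_cong)
    fix y
    have "{a. a + y \<in> {x<..}} = {x - y<..}" by auto
    then show "emeasure L {a. a + y \<in> {x<..}} = ennreal (tail L (x - y))"
      by (simp add: L.tail_eq_measure L.emeasure_eq_measure)
  qed
  also have "\<dots> = ennreal (LINT y|D. tail L (x - y))"
    by (intro nn_integral_eq_integral D.integrable_const_bound[where B=1])
       (auto simp: L.tail_nonneg L.tail_le_1)
  finally show ?thesis
    unfolding comm C.tail_eq_measure C.emeasure_eq_measure
    by (simp add: L.tail_nonneg)
qed

text \<open>A tail that vanishes at \<open>x\<close> vanishes everywhere to the right of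
  \<open>x\<close>. There the defining quotient reads 0/0, which is 0 in HOL, so it could not tend
  to 1.\<close>

lemma subexponential_tail_pos:
  assumes "subexponential D"
  shows "0 < tail D x"
proof (rule ccontr)
  interpret real_distribution D using assms by (simp add: subexponential_def)
  assume "\<not> 0 < tail D x"
  then have "tail D y = 0" if "x \<le> y" for y
    using tail_antimono[OF that] tail_nonneg[of y] by linarith
  then have "\<forall>\<^sub>F y in at_top. tail (convolution D D) y / (2 * tail D y) = 0"
    by (intro eventually_mono[OF eventually_ge_at_top[of x]]) simp
  then have "((\<lambda>y. tail (convolution D D) y / (2 * tail D y)) \<longlongrightarrow> 0) at_top"
    by (rule tendsto_eventually)
  moreover have "((\<lambda>y. tail (convolution D D) y / (2 * tail D y)) \<longlongrightarrow> 1) at_top"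
    using assms by (simp add: subexponential_def)
  ultimately show False
    using tendsto_unique[OF trivial_limit_at_top_linorder] by fastforce
qed

section \<open>The geometric counting variable\<close>

lemma geometric_sums_scaled:
  fixes p :: real
  assumes "0 < p" "p < 1"
  shows "(\<lambda>k. p * (1 - p) ^ k) sums 1"
  using sums_mult[OF geometric_sums[of "1 - p"], of p] assms by simp

context prob_space
begin

text \<open>The prescribed probabilities of the values k \<ge> 1 already sum to 1, which leaves no
  mass for the value 0.\<close>

lemma geometric_zero_null:
  assumes \<nu>: "\<nu> \<in> measurable M (count_space UNIV)" and p: "0 < p" "p < 1"
    and geom: "\<And>k. k \<ge> 1 \<Longrightarrow> measure M {\<omega> \<in> space M. \<nu> \<omega> = k} = p * (1 - p) ^ (k - 1)"
  shows "measure M {\<omega> \<in> space M. \<nu> \<omega> = (0::nat)} = 0"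
proof -
  note [measurable] = \<nu>
  let ?A = "\<lambda>k. {\<omega> \<in> space M. \<nu> \<omega> = k}"
  have "(\<lambda>k. measure M (?A k)) sums measure M (\<Union>k. ?A k)"
    by (intro measure_UNION) (auto simp: disjoint_family_on_def)
  moreover have "(\<Union>k. ?A k) = space M" by auto
  ultimately have "(\<lambda>k. measure M (?A k)) sums 1"
    by (simp add: prob_space)
  then have "(\<lambda>k. measure M (?A (Suc k))) sums (1 - measure M (?A 0))"
    by (subst sums_Suc_iff) simp
  then show ?thesis
    using sums_unique2[OF _ geometric_sums_scaled[OF p]] by (fastforce simp: geom)
qed

text \<open>\<open>geometric_pmf\<close> counts failures and starts at 0, whence the shift by
  \<open>Suc\<close>. The identification gives access to its known mean.\<close>

lemma distr_geometric:
  assumes \<nu>: "\<nu> \<in> measurable M (count_space UNIV)" and p: "0 < p" "p < 1"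
    and geom: "\<And>k. k \<ge> 1 \<Longrightarrow> measure M {\<omega> \<in> space M. \<nu> \<omega> = k} = p * (1 - p) ^ (k - 1)"
  shows "distr M (count_space UNIV) \<nu> = measure_pmf (map_pmf Suc (geometric_pmf p))"
proof (rule measure_eqI_countable[where A=UNIV])
  fix k :: nat
  have "\<nu> -` {k} \<inter> space M = {\<omega> \<in> space M. \<nu> \<omega> = k}" by auto
  then have "emeasure (distr M (count_space UNIV) \<nu>) {k} = ennreal (measure M {\<omega> \<in> space M. \<nu> \<omega> = k})"
    by (simp add: emeasure_distr[OF \<nu>] emeasure_eq_measure)
  also have "measure M {\<omega> \<in> space M. \<nu> \<omega> = k} = pmf (map_pmf Suc (geometric_pmf p)) k"
  proof (cases k)
    case 0
    then show ?thesis
      using geometric_zero_null[OF \<nu> p geom] by (simp add: pmf_eq_0_set_pmf)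
  next
    case (Suc n)
    then show ?thesis
      using geom[of k] p pmf_map_inj'[of Suc "geometric_pmf p" n] by simp
  qed
  finally show "emeasure (distr M (count_space UNIV) \<nu>) {k} =
      emeasure (measure_pmf (map_pmf Suc (geometric_pmf p))) {k}"
    by (simp add: emeasure_pmf_single)
qed simp_all

lemma expectation_geometric:
  assumes \<nu>: "\<nu> \<in> measurable M (count_space UNIV)" and p: "0 < p" "p < 1"
    and geom: "\<And>k. k \<ge> 1 \<Longrightarrow> measure M {\<omega> \<in> space M. \<nu> \<omega> = k} = p * (1 - p) ^ (k - 1)"
  shows "(LINT \<omega>|M. real (\<nu> \<omega>)) = 1 / p"
proof -
  have "(LINT \<omega>|M. real (\<nu> \<omega>)) = (LINT k|distr M (count_space UNIV) \<nu>. real k)"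
    by (rule integral_distr[OF \<nu>, symmetric]) simp
  also have "\<dots> = measure_pmf.expectation (geometric_pmf p) (\<lambda>k. 1 + real k)"
    by (simp add: distr_geometric[OF \<nu> p geom] integral_map_pmf)
  also have "\<dots> = 1 + (1 - p) / p"
    using p integrable_real_geometric_pmf[of p] expectation_geometric_pmf[of p] by simp
  finally show ?thesis
    using p by (simp add: field_simps)
qed

section \<open>Partial sums, the series for the tail of the random sum, and the renewal
  equation\<close>

lemma distr_partial_sum_Suc:
  assumes indep: "indep_vars (\<lambda>_. borel) X {1..}" and law: "\<And>i. i \<ge> 1 \<Longrightarrow> distr M borel (X i) = D"
  shows "distr M borel (\<lambda>\<omega>. \<Sum>i=1..Suc k. X i \<omega>)
    = (distr M borel (\<lambda>\<omega>. \<Sum>i=1..k. X i \<omega>) \<star> (D :: real measure))"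
proof -
  have rv [measurable]: "X i \<in> borel_measurable M" if "i \<ge> 1" for i
    using indep that by (auto simp: indep_vars_def)
  \<comment> \<open>The last summand is split off here, not the first: the remaining sum is then
    again over \<open>{1..k}\<close>, and as the summands are i.i.d. the law is the same.\<close>
  have "indep_vars (\<lambda>_. borel) X (insert (Suc k) {1..k})"
    by (rule indep_vars_subset[OF indep]) auto
  then have ind: "indep_var borel (X (Suc k)) borel (\<lambda>\<omega>. \<Sum>i\<in>{1..k}. X i \<omega>)"
    by (intro indep_vars_sum) auto
  have sm: "(\<lambda>\<omega>. \<Sum>i=1..k. X i \<omega>) \<in> borel_measurable M"
    by (intro borel_measurable_sum) (auto intro: rv)
  have "distr M borel (\<lambda>\<omega>. X (Suc k) \<omega> + (\<Sum>i=1..k. X i \<omega>))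
      = (distr M borel (X (Suc k)) \<star> distr M borel (\<lambda>\<omega>. \<Sum>i=1..k. X i \<omega>))"
    by (intro sum_indep_random_variable ind sm rv) auto
  also have "\<dots> = (distr M borel (\<lambda>\<omega>. \<Sum>i=1..k. X i \<omega>) \<star> distr M borel (X (Suc k)))"
    by (intro convolution_commutative finite_measure_distr sm rv) auto
  finally show ?thesis
    by (simp add: law add.commute)
qed

text \<open>The event is partitioned by the value of \<nu>. On \<open>\<nu> \<omega> = k\<close> the
  random sum is the k-th partial sum, and independence factors the probability of each
  piece.\<close>

lemma random_sum_geometric_sums:
  assumes rv: "\<And>i. i \<ge> 1 \<Longrightarrow> X i \<in> borel_measurable M"
    and indep: "indep_rv M (count_space UNIV) \<nu> (Pi\<^sub>M {1..} (\<lambda>_. borel)) (\<lambda>\<omega>. \<lambda>i\<in>{1..}. X i \<omega>)"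
    and p: "0 < p" "p < 1"
    and geom: "\<And>k. k \<ge> 1 \<Longrightarrow> measure M {\<omega> \<in> space M. \<nu> \<omega> = k} = p * (1 - p) ^ (k - 1)"
  shows "(\<lambda>k. p * (1 - p) ^ k * tail (distr M borel (\<lambda>\<omega>. \<Sum>i=1..Suc k. X i \<omega>)) x)
    sums measure M {\<omega> \<in> space M. random_sum X \<nu> \<omega> > x}"
proof -
  have \<nu> [measurable]: "\<nu> \<in> measurable M (count_space UNIV)"
    using indep by (simp add: indep_rv_def)
  have sm [measurable]: "(\<lambda>\<omega>. \<Sum>i=1..k. X i \<omega>) \<in> borel_measurable M" for k
    by (intro borel_measurable_sum) (auto intro: rv)
  define A where "A k = {\<omega> \<in> space M. \<nu> \<omega> = k} \<inter> {\<omega> \<in> space M. (\<Sum>i=1..k. X i \<omega>) > x}" for k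
  have A_meas: "A k \<in> sets M" for k
    unfolding A_def by measurable
  have prod: "measure M (A k) = measure M {\<omega> \<in> space M. \<nu> \<omega> = k}
      * measure M {\<omega> \<in> space M. (\<Sum>i=1..k. X i \<omega>) > x}" for k
    unfolding A_def
  proof (rule indep_setD)
    show "indep_set (sets (vimage_algebra (space M) \<nu> (count_space UNIV)))
       (sets (vimage_algebra (space M) (\<lambda>\<omega>. \<lambda>i\<in>{1..}. X i \<omega>) (Pi\<^sub>M {1..} (\<lambda>_. borel))))"
      using indep by (simp add: indep_rv_def)
    have "\<nu> -` {k} \<inter> space M \<in> sets (vimage_algebra (space M) \<nu> (count_space UNIV))"
      by (rule in_vimage_algebra) simp
    also have "\<nu> -` {k} \<inter> space M = {\<omega> \<in> space M. \<nu> \<omega> = k}" by auto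
    finally show "{\<omega> \<in> space M. \<nu> \<omega> = k} \<in> sets (vimage_algebra (space M) \<nu> (count_space UNIV))" .
    \<comment> \<open>Independence is stated for the whole sequence as a point of the product space,
      so the event about the k-th partial sum must be exhibited as the preimage of a measurable set
      of sequences.\<close>
    let ?P = "Pi\<^sub>M {1::nat..} (\<lambda>_. borel :: real measure)"
    let ?B = "{f \<in> space ?P. (\<Sum>i=1..k. f i) > x}"
    have "(\<lambda>f. \<Sum>i=1..k. f i) \<in> borel_measurable ?P"
      by (intro borel_measurable_sum measurable_component_singleton) auto
    then have "?B \<in> sets ?P"
      by measurable
    then have "(\<lambda>\<omega>. \<lambda>i\<in>{1..}. X i \<omega>) -` ?B \<inter> space M
        \<in> sets (vimage_algebra (space M) (\<lambda>\<omega>. \<lambda>i\<in>{1..}. X i \<omega>) ?P)"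
      by (rule in_vimage_algebra)
    also have "(\<lambda>\<omega>. \<lambda>i\<in>{1..}. X i \<omega>) -` ?B \<inter> space M = {\<omega> \<in> space M. (\<Sum>i=1..k. X i \<omega>) > x}"
      by (auto simp: space_PiM)
    finally show "{\<omega> \<in> space M. (\<Sum>i=1..k. X i \<omega>) > x}
        \<in> sets (vimage_algebra (space M) (\<lambda>\<omega>. \<lambda>i\<in>{1..}. X i \<omega>) ?P)" .
  qed
  have "(\<lambda>k. measure M (A k)) sums measure M (\<Union>k. A k)"
    using A_meas by (intro measure_UNION) (auto simp: disjoint_family_on_def A_def)
  moreover have "(\<Union>k. A k) = {\<omega> \<in> space M. random_sum X \<nu> \<omega> > x}"
    by (auto simp: A_def random_sum_def)
  \<comment> \<open>The piece \<nu> = 0 is null, so the series may be reindexed: its term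
    \<open>k\<close> belongs to \<nu> = \<open>Suc k\<close>.\<close>
  moreover have "measure M (A 0) = 0"
    using prod[of 0] geometric_zero_null[OF \<nu> p geom] by simp
  ultimately have "(\<lambda>k. measure M (A (Suc k))) sums measure M {\<omega> \<in> space M. random_sum X \<nu> \<omega> > x}"
    by (subst sums_Suc_iff) simp
  moreover have "measure M (A (Suc k)) = p * (1 - p) ^ k * tail (distr M borel (\<lambda>\<omega>. \<Sum>i=1..Suc k. X i \<omega>)) x" for k
  proof -
    have "real_distribution (distr M borel (\<lambda>\<omega>. \<Sum>i=1..Suc k. X i \<omega>))"
      by (rule real_distribution_distr[OF sm])
    then have "tail (distr M borel (\<lambda>\<omega>. \<Sum>i=1..Suc k. X i \<omega>)) x
        = measure M ((\<lambda>\<omega>. \<Sum>i=1..Suc k. X i \<omega>) -` {x<..} \<inter> space M)"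
      by (simp only: real_distribution.tail_eq_measure measure_distr[OF sm] greaterThan_borel)
    also have "(\<lambda>\<omega>. \<Sum>i=1..Suc k. X i \<omega>) -` {x<..} \<inter> space M = {\<omega> \<in> space M. (\<Sum>i=1..Suc k. X i \<omega>) > x}"
      by auto
    finally show ?thesis
      by (simp add: prod geom del: sum.cl_ivl_Suc)
  qed
  ultimately show ?thesis
    by simp
qed

text \<open>The term \<open>k = 0\<close> of the series is \<open>p * tail D x\<close>. Each later
  term is \<open>1 - p\<close> times the preceding one convolved with \<open>D\<close>, so the rest
  of the series is \<open>1 - p\<close> times the integral of \<open>G\<close>. Series and integral
  may be exchanged because the k-th term is at most \<open>p * (1 - p) ^ k\<close> uniformly in the
  point.\<close>

lemma random_sum_renewal:
  assumes indepX: "indep_vars (\<lambda>_. borel) X {1..}" and law: "\<And>i. i \<ge> 1 \<Longrightarrow> distr M borel (X i) = D"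
    and indep: "indep_rv M (count_space UNIV) \<nu> (Pi\<^sub>M {1..} (\<lambda>_. borel)) (\<lambda>\<omega>. \<lambda>i\<in>{1..}. X i \<omega>)"
    and p: "0 < p" "p < 1"
    and geom: "\<And>k. k \<ge> 1 \<Longrightarrow> measure M {\<omega> \<in> space M. \<nu> \<omega> = k} = p * (1 - p) ^ (k - 1)"
  defines "G \<equiv> \<lambda>x. measure M {\<omega> \<in> space M. random_sum X \<nu> \<omega> > x}"
  shows "G \<in> borel_measurable borel"
    and "G x = p * tail D x + (1 - p) * (LINT y|D. G (x - y))"
proof -
  have rv: "X i \<in> borel_measurable M" if "i \<ge> 1" for i
    using indepX that by (auto simp: indep_vars_def)
  have sm: "(\<lambda>\<omega>. \<Sum>i=1..k. X i \<omega>) \<in> borel_measurable M" for k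
    by (intro borel_measurable_sum) (auto intro: rv)
  define L where "L k = distr M borel (\<lambda>\<omega>. \<Sum>i=1..k. X i \<omega>)" for k
  have dist_L: "real_distribution (L k)" for k
    unfolding L_def by (rule real_distribution_distr[OF sm])
  note [measurable] = real_distribution.borel_measurable_tail[OF dist_L]
  have "real_distribution D"
    using real_distribution_distr[OF rv[of 1]] law[of 1] by simp
  then interpret D: real_distribution D .
  have sums: "(\<lambda>k. p * (1 - p) ^ k * tail (L (Suc k)) x) sums G x" for x
    unfolding L_def G_def by (rule random_sum_geometric_sums[OF rv indep p geom])
  have G_eq: "G = (\<lambda>x. \<Sum>k. p * (1 - p) ^ k * tail (L (Suc k)) x)"
    using sums_unique[OF sums] by auto
  show "G \<in> borel_measurable borel"
    unfolding G_eq by measurable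
  have tail_L: "tail (L (Suc k)) x = (LINT y|D. tail (L k) (x - y))" for k
    using tail_convolution[OF dist_L D.real_distribution_axioms, of k x] distr_partial_sum_Suc[OF indepX law, of k]
    by (simp add: L_def del: sum.cl_ivl_Suc)
  have L1: "tail (L (Suc 0)) x = tail D x"
    using law[of 1] by (simp add: L_def)
  have le: "norm (p * (1 - p) ^ k * tail (L j) y) \<le> p * (1 - p) ^ k" for k j y
    using p real_distribution.tail_nonneg[OF dist_L, of j y] real_distribution.tail_le_1[OF dist_L, of j y]
    by (simp add: mult_left_le)
  have summ: "summable (\<lambda>k. p * (1 - p) ^ k)"
    using geometric_sums_scaled[OF p] by (rule sums_summable)
  have int: "integrable D (\<lambda>y. p * (1 - p) ^ k * tail (L j) (x - y))" for k j
    using le by (intro D.integrable_const_bound[where B="p * (1 - p) ^ k"]) auto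
  have "(\<lambda>k. LINT y|D. p * (1 - p) ^ k * tail (L (Suc k)) (x - y))
      sums (LINT y|D. (\<Sum>k. p * (1 - p) ^ k * tail (L (Suc k)) (x - y)))"
  proof (rule sums_integral)
    show "integrable D (\<lambda>y. p * (1 - p) ^ k * tail (L (Suc k)) (x - y))" for k
      by (rule int)
    show "AE y in D. summable (\<lambda>k. norm (p * (1 - p) ^ k * tail (L (Suc k)) (x - y)))"
      by (intro AE_I2 summable_comparison_test'[OF summ]) (use le in auto)
    show "summable (\<lambda>k. LINT y|D. norm (p * (1 - p) ^ k * tail (L (Suc k)) (x - y)))"
    proof (rule summable_comparison_test'[OF summ])
      fix k :: nat
      have "(LINT y|D. norm (p * (1 - p) ^ k * tail (L (Suc k)) (x - y))) \<le> (LINT y|D. p * (1 - p) ^ k)"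
        by (intro integral_mono integrable_norm int D.integrable_const le)
      then show "norm (LINT y|D. norm (p * (1 - p) ^ k * tail (L (Suc k)) (x - y))) \<le> p * (1 - p) ^ k"
        by (simp add: D.prob_space[unfolded D.borel_UNIV])
    qed
  qed
  then have "(\<lambda>k. p * (1 - p) ^ k * tail (L (Suc (Suc k))) x) sums (LINT y|D. G (x - y))"
    by (simp add: G_eq tail_L[of "Suc _"])
  then have "(\<lambda>k. p * (1 - p) ^ Suc k * tail (L (Suc (Suc k))) x) sums ((1 - p) * (LINT y|D. G (x - y)))"
    by (drule_tac sums_mult[where c="1 - p"]) (simp add: mult_ac)
  then have "(\<lambda>k. p * (1 - p) ^ k * tail (L (Suc k)) x) sums ((1 - p) * (LINT y|D. G (x - y)) + p * tail D x)"
    by (subst (asm) sums_Suc_iff) (simp add: L1)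
  then show "G x = p * tail D x + (1 - p) * (LINT y|D. G (x - y))"
    using sums_unique2[OF sums] by force
qed

end

section \<open>The renewal equation estimated at a single point\<close>

text \<open>Since \<open>p * G z / tail D z - 1\<close> will be the relative error at
  \<open>z\<close>, \<open>v\<close> bounds this error close to \<open>x\<close>, and
  \<open>u\<close> bounds it on all of \<open>[r, x]\<close>. Only \<open>v\<close> meets a factor
  that is not small; \<open>u\<close> is multiplied by \<open>Jfun D x r\<close>.\<close>

lemma renewal_bound:
  assumes D: "real_distribution D" and D0: "measure D {..<0} = 0" and pos: "0 < tail D x"
    and G [measurable]: "G \<in> borel_measurable borel" and G01: "\<And>z. 0 \<le> G z" "\<And>z. G z \<le> 1"
    and renewal: "G x = p * tail D x + (1 - p) * (LINT y|D. G (x - y))"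
    and p: "0 < p" "p < 1" and r: "0 \<le> r" "r \<le> x - r"
    and near: "\<And>z. x - r \<le> z \<Longrightarrow> z \<le> x \<Longrightarrow> p * G z \<le> tail D z * (1 + v)"
    and mid: "\<And>z. r \<le> z \<Longrightarrow> z \<le> x \<Longrightarrow> p * G z \<le> tail D z * (1 + u)"
    and uv: "0 \<le> u" "0 \<le> v"
  shows "p * G x \<le> tail D x * (p + p * (1 - p) * Kfun D x r
    + (1 - p) * (1 + Kfun D x r) * (1 + v) + (1 - p) * Jfun D x r * (1 + u))"
proof -
  interpret real_distribution D by fact
  \<comment> \<open>A majorant of \<open>p * G (x - y)\<close> in three pieces: for
    \<open>y > x - r\<close> the bound \<open>G \<le> 1\<close>; for \<open>y \<le> r\<close> the
    bound \<open>near\<close> with the tail replaced by its largest value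
    \<open>tail D (x - r)\<close>; in between the bound \<open>mid\<close>, whose integral produces
    \<open>Jfun\<close>.\<close>
  let ?f = "\<lambda>y. p * indicator {x - r<..} y + tail D (x - r) * (1 + v) * indicator {..r} y
      + (1 + u) * (indicator {r<..x - r} y * tail D (x - y))"
  have int_mid: "integrable D (\<lambda>y. indicator {r<..x - r} y * tail D (x - y))"
    by (intro integrable_const_bound[where B=1])
       (auto simp: tail_nonneg tail_le_1 split: split_indicator)
  have int_ind: "integrable D (indicator A :: real \<Rightarrow> real)" if "A \<in> sets borel" for A
    using that by (intro integrable_real_indicator) (auto simp: emeasure_eq_measure)
  have AE_nonneg: "AE y in D. 0 \<le> y"
    using D0 by (intro AE_I[of _ _ "{..<0}"]) (auto simp: emeasure_eq_measure)
  have bound: "AE y in D. p * G (x - y) \<le> ?f y"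
    using AE_nonneg
  proof eventually_elim
    case (elim y)
    consider "y \<le> r" | "r < y" "y \<le> x - r" | "x - r < y" by linarith
    then show ?case
    proof cases
      case 1
      have "p * G (x - y) \<le> tail D (x - y) * (1 + v)"
        using elim 1 by (intro near) auto
      also have "\<dots> \<le> tail D (x - r) * (1 + v)"
        using 1 uv by (intro mult_right_mono tail_antimono) auto
      finally show ?thesis
        using 1 r by (simp add: indicator_def)
    next
      case 2
      then show ?thesis
        using mid[of "x - y"] elim by (simp add: indicator_def mult.commute)
    next
      case 3
      then show ?thesis
        using G01(2)[of "x - y"] p r by (simp add: indicator_def mult_left_le)
    qed
  qed
  have "(LINT y|D. p * G (x - y)) \<le> integral\<^sup>L D ?f"
  proof (rule integral_mono_AE[OF _ _ bound])
    show "integrable D (\<lambda>y. p * G (x - y))"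
      using G01 by (intro integrable_mult_right integrable_const_bound[where B=1]) auto
    show "integrable D ?f"
      using int_mid int_ind by (intro Bochner_Integration.integrable_add integrable_mult_right) auto
  qed
  also have "\<dots> = p * tail D (x - r) + tail D (x - r) * (1 + v) * measure D {..r}
      + (1 + u) * (LINT y|D. indicator {r<..x - r} y * tail D (x - y))"
    using int_mid int_ind by (simp add: tail_eq_measure borel_UNIV)
  also have "\<dots> \<le> p * tail D (x - r) + tail D (x - r) * (1 + v)
      + (1 + u) * (LINT y|D. indicator {r<..x - r} y * tail D (x - y))"
    using uv tail_nonneg[of "x - r"] by (simp add: mult_left_le)
  also have "tail D (x - r) = tail D x * (1 + Kfun D x r)"
    using pos by (simp add: Kfun_def)
  also have "(LINT y|D. indicator {r<..x - r} y * tail D (x - y)) = tail D x * Jfun D x r"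
    using pos by (simp add: Jfun_def set_lebesgue_integral_def)
  finally have *: "p * (LINT y|D. G (x - y)) \<le> p * (tail D x * (1 + Kfun D x r))
      + tail D x * (1 + Kfun D x r) * (1 + v) + (1 + u) * (tail D x * Jfun D x r)"
    by simp
  have "p * G x = p * p * tail D x + (1 - p) * (p * (LINT y|D. G (x - y)))"
    by (subst renewal) (simp add: algebra_simps)
  also have "\<dots> \<le> p * p * tail D x + (1 - p) * (p * (tail D x * (1 + Kfun D x r))
      + tail D x * (1 + Kfun D x r) * (1 + v) + (1 + u) * (tail D x * Jfun D x r))"
    using p by (intro add_left_mono mult_left_mono *) auto
  also have "\<dots> = tail D x * (p + p * (1 - p) * Kfun D x r
    + (1 - p) * (1 + Kfun D x r) * (1 + v) + (1 - p) * Jfun D x r * (1 + u))"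
    by (simp add: algebra_simps)
  finally show ?thesis .
qed

section \<open>From limits and local bounds to global bounds\<close>

lemma strict_bigo_imp_eventually_le:
  assumes "strict_bigo a g" and "\<forall>\<^sub>F x in at_top. 0 < g x"
  shows "\<exists>c>0. \<forall>\<^sub>F x in at_top. a x \<le> c * g x"
proof -
  obtain n :: nat where "Limsup at_top (\<lambda>x. ereal (a x / g x)) < ereal (real n)"
    using assms(1) less_PInf_Ex_of_nat by (auto simp: strict_bigo_def)
  then have "\<forall>\<^sub>F x in at_top. ereal (a x / g x) < ereal (real n)"
    by (rule Limsup_lessD)
  \<comment> \<open>The added 1 makes the constant positive even if \<open>n\<close> is 0.\<close>
  with assms(2) have "\<forall>\<^sub>F x in at_top. a x \<le> (real n + 1) * g x"
    by eventually_elim (simp add: divide_less_eq algebra_simps)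
  then show ?thesis
    by (intro exI[of _ "real n + 1"]) auto
qed

text \<open>For \<open>z\<close> in \<open>[b, x]\<close> the window \<open>[h z, z]\<close> lies in
  the union of \<open>[h b, b]\<close> and \<open>[b, x]\<close>, so \<open>step\<close> bounds the
  supremum over \<open>[b, x]\<close> in terms of itself. The assumption \<open>bdd\<close> makes
  the suprema genuine upper bounds.\<close>

lemma self_bounded_sup:
  fixes c h :: "real \<Rightarrow> real"
  assumes step: "\<And>x A. x \<ge> b \<Longrightarrow> 0 \<le> A \<Longrightarrow> (\<And>z. z \<in> {h x..x} \<Longrightarrow> c z \<le> A) \<Longrightarrow> c x \<le> \<phi> + \<delta> * A"
    and bdd: "\<And>x. x \<ge> b \<Longrightarrow> bdd_above (c ` {h b..x})"
    and c: "\<And>z. 0 \<le> c z" and h: "h b \<le> b" "\<And>x. b \<le> x \<Longrightarrow> h b \<le> h x"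
    and \<delta>: "0 < \<delta>" "\<delta> < 1" and x: "b \<le> x"
  shows "c x \<le> max (\<phi> / (1 - \<delta>)) (\<phi> + \<delta> * sup_between c (h b) b)"
proof -
  define A where "A = sup_between c (h b) b"
  define S where "S = (SUP z\<in>{b..x}. c z)"
  have A: "c z \<le> A" if "z \<in> {h b..b}" for z
    unfolding A_def sup_between_def using bdd[of b] that by (intro cSUP_upper) auto
  have "bdd_above (c ` {b..x})"
    by (rule bdd_above_mono[OF bdd[OF x]]) (use h in auto)
  then have S: "c z \<le> S" if "z \<in> {b..x}" for z
    unfolding S_def using that by (intro cSUP_upper)
  have "0 \<le> S"
    using c[of x] S[of x] x by simp
  have "c z \<le> \<phi> + \<delta> * max A S" if z: "z \<in> {b..x}" for z
  proof (rule step)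
    fix w assume "w \<in> {h z..z}"
    then have "w \<in> {h b..b} \<or> w \<in> {b..x}"
      using z h(2)[of z] by auto
    then show "c w \<le> max A S"
      using A S by fastforce
  qed (use z \<open>0 \<le> S\<close> in auto)
  then have "S \<le> \<phi> + \<delta> * max A S"
    unfolding S_def[symmetric] by (subst S_def) (use x in \<open>intro cSUP_least; auto\<close>)
  \<comment> \<open>If the maximum is \<open>S\<close>, then
    \<open>(1 - \<delta>) * S \<le> \<phi>\<close>, and \<delta> < 1 permits division; otherwise the
    second alternative is immediate.\<close>
  then have "S \<le> \<phi> / (1 - \<delta>) \<or> S \<le> \<phi> + \<delta> * A"
    using \<delta> by (auto simp: max_def pos_le_divide_eq algebra_simps split: if_splits)
  then show ?thesis
    using S[of x] x by (fastforce simp: A_def)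
qed

section \<open>Choice of the constants and conclusion\<close>

theorem theorem3p1:
  fixes M :: "'a measure"
    and X :: "nat \<Rightarrow> 'a \<Rightarrow> real" and \<nu> :: "'a \<Rightarrow> nat"
    and D :: "real measure" and p :: real and g h :: "real \<Rightarrow> real"
  assumes "prob_space M"
    and X_indep: "prob_space.indep_vars M (\<lambda>_. borel) X {1..}"
    and X_law: "\<And>i. i \<ge> 1 \<Longrightarrow> distr M borel (X i) = D"
    and X_nonneg: "\<And>i. i \<ge> 1 \<Longrightarrow> AE \<omega> in M. 0 \<le> X i \<omega>"
    and unbounded: "\<not> bdd_above (law_support D)"
    and subexp: "subexponential D"
    and p: "0 < p" "p < 1"
    and \<nu>_indep: "indep_rv M (count_space UNIV) \<nu>
                    (Pi\<^sub>M {1..} (\<lambda>_. borel)) (\<lambda>\<omega>. \<lambda>i\<in>{1..}. X i \<omega>)"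
    and \<nu>_geometric:
      "\<And>k. k \<ge> 1 \<Longrightarrow> measure M {\<omega> \<in> space M. \<nu> \<omega> = k} = p * (1 - p) ^ (k - 1)"
    and h_pos: "\<And>x. x > 0 \<Longrightarrow> h x > 0"
    and h_mono: "mono_on {0<..} h"
    and h_concave: "concave_on {0<..} h"
    and h_lim: "filterlim h at_top at_top"
    and h_half: "\<forall>\<^sub>F x in at_top. h x < x / 2"
    and h_tail: "((\<lambda>x. tail D (x - h x) / tail D x) \<longlongrightarrow> 1) at_top"
    and g_pos: "\<And>x. x > 0 \<Longrightarrow> g x > 0"
    and g_mono: "\<exists>x\<^sub>0>0. antimono_on {x\<^sub>0..} g"
    and g_lim: "(g \<longlongrightarrow> 0) at_top"
    and JK: "strict_bigo (\<lambda>x. max (Jfun D x (h x)) (Kfun D x (h x))) g"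
    and g_shift: "((\<lambda>x. g (x - h x) / g x) \<longlongrightarrow> 1) at_top"
  shows "\<exists>b \<delta> \<phi>. b > 0 \<and> 0 < \<delta> \<and> \<delta> < 1 \<and> \<phi> > 0 \<and>
           h b \<le> b \<and> bdd_above (rel_excess (Delta M X \<nu> D) g ` {h b..b}) \<and>
           (\<forall>x\<ge>b. Delta M X \<nu> D x \<le>
              max (\<phi> / (1 - \<delta>))
                  (\<phi> + \<delta> * sup_between (rel_excess (Delta M X \<nu> D) g) (h b) b) * g x)"
proof -
  interpret prob_space M by fact
  interpret D: real_distribution D
    using subexp by (simp add: subexponential_def)
  define G where "G z = measure M {\<omega> \<in> space M. random_sum X \<nu> \<omega> > z}" for z
  define \<Delta> where "\<Delta> = Delta M X \<nu> D"
  define C where "C = rel_excess \<Delta> g"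
  note tail_pos = subexponential_tail_pos[OF subexp]
  have \<nu>: "\<nu> \<in> measurable M (count_space UNIV)"
    using \<nu>_indep by (simp add: indep_rv_def)
  have G_meas: "G \<in> borel_measurable borel"
    unfolding G_def[abs_def] by (rule random_sum_renewal(1)[OF X_indep X_law \<nu>_indep p \<nu>_geometric])
  have renewal: "G x = p * tail D x + (1 - p) * (LINT y|D. G (x - y))" for x
    unfolding G_def by (rule random_sum_renewal(2)[OF X_indep X_law \<nu>_indep p \<nu>_geometric])
  have G01: "0 \<le> G z" "G z \<le> 1" for z
    by (simp_all add: G_def)
  \<comment> \<open>The mean of \<nu> is 1/p, so this is the definition of \<Delta> solved for
    \<open>G\<close>. It translates between bounds on \<Delta> and the hypotheses of
    \<open>renewal_bound\<close>.\<close>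
  have pG: "p * G z = tail D z * (1 + \<Delta> z)" for z
    using tail_pos[of z] p
    by (simp add: \<Delta>_def Delta_def expectation_geometric[OF \<nu> p \<nu>_geometric] G_def[symmetric] field_simps)
  obtain x\<^sub>0 where x0: "x\<^sub>0 > 0" "antimono_on {x\<^sub>0..} g"
    using g_mono by blast
  have g_anti: "g y \<le> g z" if "x\<^sub>0 \<le> z" "z \<le> y" for y z
    using monotone_onD[OF x0(2), of z y] that by simp
  have ev_g: "\<forall>\<^sub>F x in at_top. 0 < g x"
    using eventually_gt_at_top[of 0] by eventually_elim (rule g_pos)
  obtain c where c: "c > 0" "\<forall>\<^sub>F x in at_top. max (Jfun D x (h x)) (Kfun D x (h x)) \<le> c * g x"
    using strict_bigo_imp_eventually_le[OF JK ev_g] by blast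
  \<comment> \<open>In \<delta>, one factor \<open>1 + \<epsilon>\<close> will bound
    \<open>1 + Kfun\<close>, the other the ratio of \<open>g (x - h x)\<close> to
    \<open>g x\<close>, and \<open>c * \<epsilon>\<close> comes from \<open>Jfun\<close> together
    with \<open>g (h x) \<le> \<epsilon>\<close>. With \<epsilon> \<le> 1 the bracket is at most
    \<open>1 + (3 + c) * \<epsilon>\<close>, hence at most \<open>1 + p\<close>, and \<delta> \<le>
    1 - p^2 < 1.\<close>
  define \<epsilon> where "\<epsilon> = min 1 (p / (3 + c))"
  define \<delta> where "\<delta> = (1 - p) * ((1 + \<epsilon>) * (1 + \<epsilon>) + c * \<epsilon>)"
  have \<epsilon>: "0 < \<epsilon>" "\<epsilon> \<le> 1" "(3 + c) * \<epsilon> \<le> p"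
    using p c(1) by (auto simp: \<epsilon>_def min_def field_simps)
  have \<delta>: "0 < \<delta>" "\<delta> < 1"
  proof -
    show "0 < \<delta>"
      unfolding \<delta>_def using p c(1) \<epsilon> by (intro mult_pos_pos add_pos_pos) auto
    have "(1 + \<epsilon>) * (1 + \<epsilon>) + c * \<epsilon> \<le> 1 + (3 + c) * \<epsilon>"
      using \<epsilon>(1,2) by (simp add: algebra_simps mult_left_le)
    then have "(1 + \<epsilon>) * (1 + \<epsilon>) + c * \<epsilon> \<le> 1 + p"
      using \<epsilon>(3) by linarith
    then have "\<delta> \<le> (1 - p) * (1 + p)"
      unfolding \<delta>_def using p by (intro mult_left_mono) auto
    also have "\<dots> < 1"
      using p by (simp add: algebra_simps)
    finally show "\<delta> < 1" .
  qed
  have "\<forall>\<^sub>F x in at_top. tail D (x - h x) / tail D x < 1 + \<epsilon>"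
    using order_tendstoD(2)[OF h_tail] \<epsilon> by simp
  moreover have "\<forall>\<^sub>F x in at_top. g (x - h x) / g x < 1 + \<epsilon>"
    using order_tendstoD(2)[OF g_shift] \<epsilon> by simp
  moreover have "\<forall>\<^sub>F x in at_top. x\<^sub>0 \<le> h x"
    using h_lim by (simp add: filterlim_at_top)
  moreover have "\<forall>\<^sub>F x in at_top. g (h x) < \<epsilon>"
    using order_tendstoD(2)[OF filterlim_compose[OF g_lim h_lim]] \<epsilon> by simp
  ultimately have "\<forall>\<^sub>F x in at_top. max (Jfun D x (h x)) (Kfun D x (h x)) \<le> c * g x
      \<and> Kfun D x (h x) \<le> \<epsilon> \<and> g (x - h x) \<le> (1 + \<epsilon>) * g x
      \<and> x\<^sub>0 \<le> h x \<and> g (h x) \<le> \<epsilon> \<and> h x < x / 2 \<and> 0 < x"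
    using c(2) h_half eventually_gt_at_top[of 0] ev_g
    by eventually_elim (simp add: Kfun_def pos_divide_less_eq)
  \<comment> \<open>All the asymptotic relations hold from \<open>b\<close> on. The condition
    \<open>x\<^sub>0 \<le> h x\<close> places the whole window \<open>[h x, x]\<close> where
    \<open>g\<close> is decreasing.\<close>
  then obtain b where b: "\<And>x. b \<le> x \<Longrightarrow> max (Jfun D x (h x)) (Kfun D x (h x)) \<le> c * g x
      \<and> Kfun D x (h x) \<le> \<epsilon> \<and> g (x - h x) \<le> (1 + \<epsilon>) * g x
      \<and> x\<^sub>0 \<le> h x \<and> g (h x) \<le> \<epsilon> \<and> h x < x / 2 \<and> 0 < x"
    by (auto simp: eventually_at_top_linorder)
  have b_pos: "0 < b" and hb: "h b \<le> b" and x0_hb: "x\<^sub>0 \<le> h b"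
    using b[of b] by auto
  have h_ge: "h b \<le> h x" if "b \<le> x" for x
    using monotone_onD[OF h_mono, of b x] b_pos that by simp

  have step: "C x \<le> 3 * c + \<delta> * A"
    if x: "b \<le> x" and A: "0 \<le> A" and C_le: "\<And>z. z \<in> {h x..x} \<Longrightarrow> C z \<le> A" for x A
  proof -
    let ?K = "Kfun D x (h x)" and ?J = "Jfun D x (h x)" and ?q = "1 - p"
    \<comment> \<open>For \<open>z\<close> in \<open>[x - h x, x]\<close> one has
      \<open>g z \<le> g (x - h x) \<le> (1 + \<epsilon>) * g x\<close>, so \<open>v\<close> bounds
      \<Delta> there. On the longer window only \<open>g z \<le> g (h x) \<le> \<epsilon>\<close> is
      available, which gives \<open>A * \<epsilon>\<close> in the role of \<open>u\<close>.\<close>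
    define v where "v = A * ((1 + \<epsilon>) * g x)"
    have bx: "?J \<le> c * g x" "?K \<le> c * g x" "?K \<le> \<epsilon>" "g (x - h x) \<le> (1 + \<epsilon>) * g x"
        "x\<^sub>0 \<le> h x" "g (h x) \<le> \<epsilon>" "h x < x / 2" "0 < x"
      using b[OF x] by auto
    have gx: "0 < g x"
      using bx g_pos by simp
    have \<Delta>_le: "\<Delta> z \<le> A * g z" if "z \<in> {h x..x}" for z
    proof -
      have "0 < g z"
        using that bx x0(1) by (intro g_pos) auto
      then show ?thesis
        using C_le[OF that] by (simp add: C_def rel_excess_def divide_le_eq)
    qed
    have "p * G x \<le> tail D x * (p + p * ?q * ?K + ?q * (1 + ?K) * (1 + v) + ?q * ?J * (1 + A * \<epsilon>))"
    proof (rule renewal_bound[OF D.real_distribution_axioms _ tail_pos G_meas G01 renewal p])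
      show "measure D {..<0} = 0"
        using subexp by (simp add: subexponential_def)
      show "p * G z \<le> tail D z * (1 + v)" if "x - h x \<le> z" "z \<le> x" for z
      proof -
        have "g z \<le> (1 + \<epsilon>) * g x"
          using g_anti[of "x - h x" z] that bx by linarith
        then have "\<Delta> z \<le> v"
          using \<Delta>_le[of z] mult_left_mono[OF _ A, of "g z" "(1 + \<epsilon>) * g x"] that bx
          by (simp add: v_def)
        then show ?thesis
          unfolding pG by (intro mult_left_mono D.tail_nonneg) simp
      qed
      show "p * G z \<le> tail D z * (1 + A * \<epsilon>)" if "h x \<le> z" "z \<le> x" for z
      proof -
        have "g z \<le> \<epsilon>"
          using g_anti[of "h x" z] that bx by linarith
        then have "\<Delta> z \<le> A * \<epsilon>"
          using \<Delta>_le[of z] mult_left_mono[OF _ A, of "g z" \<epsilon>] that by simp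
        then show ?thesis
          unfolding pG by (intro mult_left_mono D.tail_nonneg) simp
      qed
      show "0 \<le> h x" "h x \<le> x - h x"
        using bx x0(1) by auto
      show "0 \<le> A * \<epsilon>" "0 \<le> v"
        using A \<epsilon> gx by (simp_all add: v_def)
    qed
    then have "1 + \<Delta> x \<le> p + p * ?q * ?K + ?q * (1 + ?K) * (1 + v) + ?q * ?J * (1 + A * \<epsilon>)"
      unfolding pG using tail_pos[of x] by simp
    \<comment> \<open>The constants cancel because \<open>p + ?q = 1\<close>. Next,
      \<open>?K\<close> is bounded in two ways: by \<open>c * g x\<close> where it stands alone, and
      by \<epsilon> where it multiplies \<open>v\<close>, which already carries a factor
      \<open>g x\<close>.\<close>
    then have "\<Delta> x \<le> (p * ?q + ?q) * ?K + (?q * v) * (1 + ?K) + (?q * (1 + A * \<epsilon>)) * ?J"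
      by (simp add: algebra_simps)
    also have "\<dots> \<le> (p * ?q + ?q) * (c * g x) + (?q * v) * (1 + \<epsilon>) + (?q * (1 + A * \<epsilon>)) * (c * g x)"
      using p A \<epsilon> gx bx by (intro add_mono mult_left_mono) (auto simp: v_def)
    also have "\<dots> = ((p * ?q + ?q + ?q) * c + \<delta> * A) * g x"
      by (simp add: v_def \<delta>_def algebra_simps)
    also have "\<dots> \<le> (3 * c + \<delta> * A) * g x"
    proof (intro mult_right_mono add_right_mono)
      have "p * ?q \<le> 1"
        using p by (intro mult_le_one) auto
      then show "p * ?q + ?q + ?q \<le> 3"
        using p by linarith
    qed (use c gx in auto)
    \<comment> \<open>The bound is nonnegative, so it also covers the case in which
      \<open>C x\<close> is 0.\<close>
    finally show ?thesis
      using c(1) \<delta> A gx by (simp add: C_def rel_excess_def divide_le_eq)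
  qed

  \<comment> \<open>From \<open>p * G z \<le> 1\<close>, positive values of
    \<open>\<Delta> z\<close> are at most \<open>1 / tail D z\<close>. On \<open>[h b, x]\<close>
    both \<open>tail D\<close> and \<open>g\<close> are decreasing and hence bounded below by their
    positive values at \<open>x\<close>.\<close>
  have bdd: "bdd_above (C ` {h b..x})" if x: "b \<le> x" for x
  proof (rule bdd_aboveI2)
    fix z assume z: "z \<in> {h b..x}"
    have gx: "0 < g x" and gz: "0 < g z" and tx: "0 < tail D x"
      using b_pos x0(1) x0_hb x z tail_pos by (auto intro!: g_pos)
    have "tail D x * \<Delta> z \<le> 1"
    proof (cases "\<Delta> z \<le> 0")
      case True
      then show ?thesis
        using tx by (smt (verit) mult_nonneg_nonpos)
    next
      case False
      then have "tail D x * \<Delta> z \<le> tail D z * (1 + \<Delta> z)"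
        using z D.tail_nonneg[of z] by (intro mult_mono D.tail_antimono) auto
      also have "\<dots> \<le> 1"
        unfolding pG[symmetric] using p G01[of z] by (intro mult_le_one) auto
      finally show ?thesis .
    qed
    then have \<Delta>z: "\<Delta> z \<le> 1 / tail D x"
      using tx by (simp add: field_simps)
    have "g x \<le> g z"
      using z x0_hb by (intro g_anti) auto
    have "\<Delta> z / g z \<le> (1 / tail D x) / g z"
      using \<Delta>z gz by (intro divide_right_mono) auto
    also have "\<dots> \<le> (1 / tail D x) / g x"
      using \<open>g x \<le> g z\<close> gx tx by (intro divide_left_mono) auto
    finally show "C z \<le> (1 / tail D x) / g x"
      using tx gx by (simp add: C_def rel_excess_def)
  qed

  have "\<Delta> x \<le> max (3 * c / (1 - \<delta>)) (3 * c + \<delta> * sup_between C (h b) b) * g x" if x: "b \<le> x" for x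
  proof -
    have "C x \<le> max (3 * c / (1 - \<delta>)) (3 * c + \<delta> * sup_between C (h b) b)"
    proof (rule self_bounded_sup[where h = h and c = C and b = b, OF step bdd _ hb h_ge \<delta> x])
      show "0 \<le> C z" for z
        by (simp add: C_def rel_excess_def)
    qed
    moreover have "\<Delta> x / g x \<le> C x"
      by (simp add: C_def rel_excess_def)
    ultimately have "\<Delta> x / g x \<le> max (3 * c / (1 - \<delta>)) (3 * c + \<delta> * sup_between C (h b) b)"
      by linarith
    then show ?thesis
      using g_pos[of x] b_pos x by (simp only: pos_divide_le_eq)
  qed
  \<comment> \<open>The conjuncts \<open>h b \<le> b\<close> and \<open>bdd_above\<close> certify
    that \<open>sup_between\<close> is a supremum over a nonempty set on which the function is
    bounded, hence not an unspecified value; the latter is \<open>bdd\<close> at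
    \<open>x = b\<close>.\<close>
  then show ?thesis
    using b_pos \<delta> c(1) hb bdd[of b] unfolding C_def \<Delta>_def
    by (intro exI[of _ b] exI[of _ \<delta>] exI[of _ "3 * c"]) simp
qed

end
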